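(* Let $M \in \mathrm{Sp}(2n;\mathbb{R})$ be diagonalizable (over $\mathbb{C}$) with mutually distinct eigenvalues, all on the unit circle, and let $V \in \mathrm{Sp}(2n;\mathbb{R})$ be a linear normal form map for $M$. Let $G\in\mathbb{R}^{2n\times 2n}$ be symmetric positive definite with $M G M^{tr} = G$, and let $G = S^{tr} D S$ with $S \in \mathrm{Sp}(2n;\mathbb{R})$, $D = \mathrm{diag}(\Lambda,\Lambda)$, $\Lambda = \mathrm{diag}(\lambda_1,\dots,\lambda_n)$, where $\lambda_1,\dots,\lambda_n$ are mutually distinct. Let $S = KAN$ and $V^{tr} = K'A'N'$ be the Iwasawa decompositions. Then: (1) $A = A'$ and $N = N'$. (2) $K = P\,(D_1 + J D_2)\,K'$, where $P$ is a symplectic permutation and $D_1 = \mathrm{diag}(\Delta_1,\Delta_1)$, $D_2 = \mathrm{diag}(\Delta_2,\Delta_2)$ with real diagonal $n\times n$ matrices $\Delta_1,\Delta_2$ satisfying $D_1^2 + D_2^2 = 1$. (3) $S^{tr}$ is again a linear normal form map for $M$, i.e. $S^{-tr} M S^{tr}$ leaves every plane $\mathrm{span}\{e_k,e_{n+k}\}$, $k = 1,\dots,n$, invariant and acts on it as a rotation $\begin{pmatrix} \cos\psi_k & \sin\psi_k \\ -\sin\psi_k & \cos\psi_k\end{pmatrix}$ for some $\psi_k \in [0,2\pi)$.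
   Context: $J = \begin{pmatrix} 0 & 1_n \\ -1_n & 0\end{pmatrix}$, and $\mathrm{Sp}(2n;\mathbb{R})$ is the group of real $2n \times 2n$ matrices $S$ with $S^{tr} J S = J$; $S^{-tr} := (S^{-1})^{tr}$. A linear normal form map for $M$ is a matrix $V \in \mathrm{Sp}(2n;\mathbb{R})$ such that $V^{-1} M V$ leaves every plane $\mathrm{span}\{e_k, e_{n+k}\}$, $k=1,\dots,n$, invariant and acts on it, in the basis $(e_k,e_{n+k})$, by a rotation matrix $\begin{pmatrix} \cos\varphi_k & \sin\varphi_k \\ -\sin\varphi_k & \cos\varphi_k\end{pmatrix}$, $\varphi_k\in[0,2\pi)$; it exists for every $M$ as in the claim. Iwasawa decomposition: every $S \in \mathrm{Sp}(2n;\mathbb{R})$ can be written uniquely as $S = KAN$ with symplectic $K,A,N$ such that $K \in \mathrm{Sp}(2n;\mathbb{R}) \cap O(2n;\mathbb{R})$; $A = \mathrm{diag}(B,B^{-1})$ with $B = \mathrm{diag}(b_1,\dots,b_n)$, $b_j>0$; and $N = \begin{pmatrix} E & F \\ 0 & E^{-tr}\end{pmatrix}$ with $E$ real unit upper triangular and $EF^{tr} = FE^{tr}$. For distinct $a,b \in \{1,\dots,n\}$ let $T_{ab}$ be the linear map with $T_{ab}e_a = -e_{n+b}$, $T_{ab}e_{n+a} = e_b$, $T_{ab}e_b = -e_{n+a}$, $T_{ab}e_{n+b} = e_a$ and $T_{ab}e_j = e_j$ for all other $j$; it is orthogonal and symplectic. A symplectic permutation is a finite (possibly empty) product of such maps $T_{ab}$.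 *)

theory Defs
  imports "HOL-Analysis.Analysis"
begin

text \<open>
  The \<open>2n\<close> coordinates are indexed by the sum type \<open>'n + 'n\<close> with \<open>n = CARD('n)\<close>: the basis vector
  \<open>e\<^sub>k\<close> is \<open>axis (Inl k) 1\<close> and \<open>e\<^sub>n\<^sub>+\<^sub>k\<close> is \<open>axis (Inr k) 1\<close>. A linear order on \<open>'n\<close>, which identifies
  \<open>'n\<close> with \<open>{1..n}\<close>, is needed only to speak of upper triangular matrices.
  Note that matrix products and powers have to be written with \<open>**\<close>, since \<open>*\<close> and \<open>^\<close> are
  componentwise on the vector type.
\<close>

type_synonym 'n dmat = "real ^ ('n + 'n) ^ ('n + 'n)"

definition block_matrix ::
    "'a ^ 'n ^ 'n \<Rightarrow> 'a ^ 'n ^ 'n \<Rightarrow> 'a ^ 'n ^ 'n \<Rightarrow> 'a ^ 'n ^ 'n \<Rightarrow> 'a ^ ('n + 'n) ^ ('n + 'n)" where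
  "block_matrix X Y Z W =
     (\<chi> i j. case (i, j) of
        (Inl k, Inl l) \<Rightarrow> X $ k $ l
      | (Inl k, Inr l) \<Rightarrow> Y $ k $ l
      | (Inr k, Inl l) \<Rightarrow> Z $ k $ l
      | (Inr k, Inr l) \<Rightarrow> W $ k $ l)"

definition diag_matrix :: "('n \<Rightarrow> 'a::zero) \<Rightarrow> 'a ^ 'n ^ 'n" where
  "diag_matrix d = (\<chi> i j. if i = j then d i else 0)"

definition J_matrix :: "'n::finite dmat" where
  "J_matrix = block_matrix 0 (mat 1) (- mat 1) 0"

definition Sp :: "'n::finite dmat set" where
  "Sp = {S. transpose S ** J_matrix ** S = J_matrix}"

definition symmetric_matrix :: "'a ^ 'm ^ 'm \<Rightarrow> bool" where
  "symmetric_matrix G \<longleftrightarrow> transpose G = G"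

definition positive_definite :: "real ^ 'm ^ 'm \<Rightarrow> bool" where
  "positive_definite G \<longleftrightarrow> (\<forall>x. x \<noteq> 0 \<longrightarrow> x \<bullet> (G *v x) > 0)"

definition complex_matrix :: "real ^ 'm ^ 'm \<Rightarrow> complex ^ 'm ^ 'm" where
  "complex_matrix M = map_matrix complex_of_real M"

definition eigenvalues :: "'a::field ^ 'm ^ 'm \<Rightarrow> 'a set" where
  "eigenvalues M = {\<mu>. \<exists>v. v \<noteq> 0 \<and> M *v v = \<mu> *s v}"

definition diagonalizable :: "'a::field ^ 'm ^ 'm \<Rightarrow> bool" where
  "diagonalizable M \<longleftrightarrow>
     (\<exists>(Q :: 'a ^ 'm ^ 'm) d. invertible Q \<and> matrix_inv Q ** M ** Q = diag_matrix d)"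

definition symp_plane :: "'n::finite \<Rightarrow> (real ^ ('n + 'n)) set" where
  "symp_plane k = span {axis (Inl k) 1, axis (Inr k) 1}"

text \<open>The columns of the matrix of a linear map in the basis \<open>(e\<^sub>k, e\<^sub>n\<^sub>+\<^sub>k)\<close> are the images of the
  basis vectors.\<close>

definition acts_as_rotation :: "'n::finite dmat \<Rightarrow> 'n \<Rightarrow> real \<Rightarrow> bool" where
  "acts_as_rotation L k \<phi> \<longleftrightarrow>
     (*v) L ` symp_plane k \<subseteq> symp_plane k \<and>
     L *v axis (Inl k) 1 = cos \<phi> *s axis (Inl k) 1 - sin \<phi> *s axis (Inr k) 1 \<and>
     L *v axis (Inr k) 1 = sin \<phi> *s axis (Inl k) 1 + cos \<phi> *s axis (Inr k) 1"

definition linear_normal_form_map :: "'n::finite dmat \<Rightarrow> 'n dmat \<Rightarrow> bool" where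
  "linear_normal_form_map M V \<longleftrightarrow>
     V \<in> Sp \<and> (\<forall>k. \<exists>\<phi>\<in>{0..<2*pi}. acts_as_rotation (matrix_inv V ** M ** V) k \<phi>)"

definition unit_upper_triangular :: "real ^ ('n::{finite,linorder}) ^ ('n::{finite,linorder}) \<Rightarrow> bool" where
  "unit_upper_triangular E \<longleftrightarrow> (\<forall>i. E $ i $ i = 1) \<and> (\<forall>i j. j < i \<longrightarrow> E $ i $ j = 0)"

definition iwasawa_K :: "'n::{finite,linorder} dmat set" where
  "iwasawa_K = {K \<in> Sp. orthogonal_matrix K}"

definition iwasawa_A :: "'n::{finite,linorder} dmat set" where
  "iwasawa_A = {A \<in> Sp. \<exists>b. (\<forall>j. b j > 0) \<and>
     A = block_matrix (diag_matrix b) 0 0 (matrix_inv (diag_matrix b))}"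

definition iwasawa_N :: "'n::{finite,linorder} dmat set" where
  "iwasawa_N = {N \<in> Sp. \<exists>E F. unit_upper_triangular E \<and>
     E ** transpose F = F ** transpose E \<and>
     N = block_matrix E F 0 (transpose (matrix_inv E))}"

definition iwasawa_decomposition ::
    "'n::{finite,linorder} dmat \<Rightarrow> 'n dmat \<Rightarrow> 'n dmat \<Rightarrow> 'n dmat \<Rightarrow> bool" where
  "iwasawa_decomposition S K A N \<longleftrightarrow>
     K \<in> iwasawa_K \<and> A \<in> iwasawa_A \<and> N \<in> iwasawa_N \<and> S = K ** A ** N"

definition symp_swap_image :: "'n::finite \<Rightarrow> 'n \<Rightarrow> 'n + 'n \<Rightarrow> real ^ ('n + 'n)" where
  "symp_swap_image a b j =
     (if j = Inl a then - axis (Inr b) 1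
      else if j = Inr a then axis (Inl b) 1
      else if j = Inl b then - axis (Inr a) 1
      else if j = Inr b then axis (Inl a) 1
      else axis j 1)"

text \<open>The matrix of \<open>T\<^sub>a\<^sub>b\<close>: its \<open>j\<close>-th column is \<open>symp_swap_image a b j\<close>.\<close>

definition symp_swap :: "'n::finite \<Rightarrow> 'n \<Rightarrow> 'n dmat" where
  "symp_swap a b = (\<chi> i j. symp_swap_image a b j $ i)"

inductive symplectic_permutation :: "'n::finite dmat \<Rightarrow> bool" where
  symplectic_permutation_empty: "symplectic_permutation (mat 1)"
| symplectic_permutation_swap:
    "a \<noteq> b \<Longrightarrow> symplectic_permutation P \<Longrightarrow> symplectic_permutation (symp_swap a b ** P)"

end

theory Submission
  imports Defs
begin

text \<open>
  In normal form coordinates \<open>M\<close> is a diagonal matrix over \<open>\<complex> = \<real>[J]\<close> with simple spectrum, so the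
  invariant form \<open>V\<^sup>-\<^sup>1 G V\<^sup>-\<^sup>t\<^sup>r\<close> commutes with it and, being symmetric, is \<open>diag(\<Gamma>, \<Gamma>)\<close>. Hence
  \<open>U = S V\<^sup>-\<^sup>t\<^sup>r\<close> is a symplectic congruence between the positive diagonal forms \<open>D\<close> and
  \<open>diag(\<Gamma>, \<Gamma>)\<close>. Such a \<open>U\<close> is a similarity between \<open>J D\<close> and \<open>J diag(\<Gamma>, \<Gamma>)\<close>, and since the
  \<open>\<lambda>\<^sub>k\<close> are positive and distinct it permutes the coordinate planes and commutes with \<open>J\<close>; therefore it
  is orthogonal. From \<open>S = U V\<^sup>t\<^sup>r = (U K') A' N'\<close> uniqueness of the Iwasawa decomposition gives (1)
  and \<open>K = U K'\<close>; splitting off from \<open>U\<close> a symplectic permutation with the same permutation of the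
  planes leaves a complex diagonal unitary, which is (2). Conjugating the normal form by \<open>U\<close> only
  permutes the rotation angles, which is (3).
\<close>

section \<open>Entries and sums over the doubled index set\<close>

lemma sum_UNIV_Plus:
  fixes f :: "'a::finite + 'b::finite \<Rightarrow> 'c::comm_monoid_add"
  shows "sum f UNIV = (\<Sum>k\<in>UNIV. f (Inl k)) + (\<Sum>k\<in>UNIV. f (Inr k))"
  by (simp flip: UNIV_Plus_UNIV add: sum.Plus)

lemma block_matrix_nth [simp]:
  "block_matrix X Y Z W $ Inl k $ Inl l = X $ k $ l"
  "block_matrix X Y Z W $ Inl k $ Inr l = Y $ k $ l"
  "block_matrix X Y Z W $ Inr k $ Inl l = Z $ k $ l"
  "block_matrix X Y Z W $ Inr k $ Inr l = W $ k $ l"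
  by (simp_all add: block_matrix_def)

lemma diag_matrix_nth: "diag_matrix d $ i $ j = (if i = j then d i else 0)"
  by (simp add: diag_matrix_def)

lemma sum_matrix_eq_iff:
  "X = Y \<longleftrightarrow>
    (\<forall>k l. X $ Inl k $ Inl l = Y $ Inl k $ Inl l \<and> X $ Inl k $ Inr l = Y $ Inl k $ Inr l \<and>
           X $ Inr k $ Inl l = Y $ Inr k $ Inl l \<and> X $ Inr k $ Inr l = Y $ Inr k $ Inr l)"
  for X Y :: "'a ^ ('n::finite + 'n) ^ ('n + 'n)"
proof
  assume *: "\<forall>k l. X $ Inl k $ Inl l = Y $ Inl k $ Inl l \<and> X $ Inl k $ Inr l = Y $ Inl k $ Inr l \<and>
           X $ Inr k $ Inl l = Y $ Inr k $ Inl l \<and> X $ Inr k $ Inr l = Y $ Inr k $ Inr l"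
  have "X $ i $ j = Y $ i $ j" for i j
    using * by (cases i; cases j) auto
  then show "X = Y"
    by (simp add: vec_eq_iff)
qed auto


section \<open>Complex diagonal matrices\<close>

text \<open>Identifying \<open>\<real>\<^sup>2\<^sup>n\<close> with \<open>\<complex>\<^sup>n\<close> so that \<open>J\<close> becomes multiplication by \<open>\<i>\<close>, this is the diagonal
  matrix with entries \<open>c k + \<i> s k\<close>.\<close>

definition cdiag :: "('n \<Rightarrow> real) \<Rightarrow> ('n \<Rightarrow> real) \<Rightarrow> 'n::finite dmat" where
  "cdiag c s = block_matrix (diag_matrix c) (diag_matrix s) (- diag_matrix s) (diag_matrix c)"

lemma cdiag_nth [simp]:
  "cdiag c s $ Inl k $ Inl l = (if k = l then c k else 0)"
  "cdiag c s $ Inl k $ Inr l = (if k = l then s k else 0)"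
  "cdiag c s $ Inr k $ Inl l = (if k = l then - s k else 0)"
  "cdiag c s $ Inr k $ Inr l = (if k = l then c k else 0)"
  by (simp_all add: cdiag_def diag_matrix_nth)

lemma cdiag_mult_nth:
  "(cdiag c s ** X) $ Inl k $ j = c k * X $ Inl k $ j + s k * X $ Inr k $ j"
  "(cdiag c s ** X) $ Inr k $ j = - s k * X $ Inl k $ j + c k * X $ Inr k $ j"
  by (simp_all add: matrix_matrix_mult_def sum_UNIV_Plus if_distrib[of "\<lambda>x. x * _"] cong: if_cong)

lemma mult_cdiag_nth:
  "(X ** cdiag c s) $ i $ Inl l = X $ i $ Inl l * c l - X $ i $ Inr l * s l"
  "(X ** cdiag c s) $ i $ Inr l = X $ i $ Inl l * s l + X $ i $ Inr l * c l"
  by (simp_all add: matrix_matrix_mult_def sum_UNIV_Plus if_distrib[of "\<lambda>x. _ * x"] cong: if_cong)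

lemma J_matrix_eq_cdiag: "J_matrix = cdiag (\<lambda>_. 0) (\<lambda>_. 1)"
  by (simp add: sum_matrix_eq_iff J_matrix_def mat_def)

lemma mat_1_eq_cdiag: "mat 1 = cdiag (\<lambda>_. 1) (\<lambda>_. 0)"
  by (simp add: sum_matrix_eq_iff mat_def)

lemma block_diag_eq_cdiag: "block_matrix (diag_matrix d) 0 0 (diag_matrix d) = cdiag d (\<lambda>_. 0)"
  by (simp add: sum_matrix_eq_iff diag_matrix_nth)

lemma cdiag_add: "cdiag c s + cdiag c' s' = cdiag (\<lambda>k. c k + c' k) (\<lambda>k. s k + s' k)"
  by (simp add: sum_matrix_eq_iff)

lemma cdiag_mult:
  "cdiag c s ** cdiag c' s' = cdiag (\<lambda>k. c k * c' k - s k * s' k) (\<lambda>k. c k * s' k + s k * c' k)"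
  by (simp add: sum_matrix_eq_iff cdiag_mult_nth)

lemma transpose_cdiag: "transpose (cdiag c s) = cdiag c (\<lambda>k. - s k)"
  by (simp add: sum_matrix_eq_iff transpose_def)

lemma cdiag_inject: "cdiag c s = cdiag c' s' \<longleftrightarrow> c = c' \<and> s = s'"
  by (auto simp: sum_matrix_eq_iff split: if_splits)

text \<open>Commuting with \<open>J_matrix\<close> is complex linearity: the upper half of the
  matrix determines the lower half.\<close>

lemma commute_J_matrix_iff:
  "X ** J_matrix = J_matrix ** X \<longleftrightarrow>
    (\<forall>k l. X $ Inr k $ Inr l = X $ Inl k $ Inl l \<and> X $ Inr k $ Inl l = - X $ Inl k $ Inr l)"
  for X :: "'n::finite dmat"
  by (auto simp: sum_matrix_eq_iff J_matrix_eq_cdiag cdiag_mult_nth mult_cdiag_nth)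


section \<open>The symplectic group\<close>

lemma J_matrix_square: "J_matrix ** J_matrix = - mat 1"
  by (simp add: sum_matrix_eq_iff J_matrix_eq_cdiag cdiag_mult mat_def)

lemma matrix_mul_minus:
  fixes X Y :: "real ^ 'n ^ 'n"
  shows "(- X) ** Y = - (X ** Y)" "X ** (- Y) = - (X ** Y)"
  by (simp_all add: vec_eq_iff matrix_matrix_mult_def sum_negf)

text \<open>The symplectic relation exhibits \<open>- (J_matrix ** transpose S ** J_matrix)\<close>
  as a left inverse of \<open>S\<close>. For square matrices it is also a right inverse, and
  multiplying that equation by \<open>J_matrix\<close> yields the relation for the
  transpose.\<close>

lemma Sp_transpose:
  assumes "S \<in> Sp" shows "transpose S \<in> Sp"
proof -
  have S: "transpose S ** J_matrix ** S = J_matrix"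
    using assms by (simp add: Sp_def)
  have "- (J_matrix ** transpose S ** J_matrix) ** S = mat 1"
    using S by (simp add: matrix_mul_minus J_matrix_square flip: matrix_mul_assoc)
  then have "S ** - (J_matrix ** transpose S ** J_matrix) = mat 1"
    by (simp add: matrix_left_right_inverse)
  then have "S ** J_matrix ** transpose S ** J_matrix = - mat 1"
    by (simp add: matrix_mul_minus matrix_mul_assoc neg_eq_iff_add_eq_0 add_eq_0_iff2)
  then have "S ** J_matrix ** transpose S ** (J_matrix ** J_matrix) = - J_matrix"
    by (simp add: matrix_mul_assoc matrix_mul_minus)
  then show ?thesis
    by (simp add: Sp_def J_matrix_square matrix_mul_minus)
qed

lemma Sp_mult:
  assumes "S \<in> Sp" "T \<in> Sp" shows "S ** T \<in> Sp"
proof -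
  have "transpose (S ** T) ** J_matrix ** (S ** T) =
      transpose T ** (transpose S ** J_matrix ** S) ** T"
    by (simp add: matrix_transpose_mul matrix_mul_assoc)
  then show ?thesis
    using assms by (simp add: Sp_def)
qed

lemma Sp_invertible:
  assumes "S \<in> Sp" shows "invertible S"
proof -
  have S: "transpose S ** J_matrix ** S = J_matrix"
    using assms by (simp add: Sp_def)
  have "- (J_matrix ** transpose S ** J_matrix) ** S = mat 1"
    using S by (simp add: matrix_mul_minus J_matrix_square flip: matrix_mul_assoc)
  then show ?thesis
    using invertible_left_inverse by blast
qed

lemma Sp_inverse:
  assumes S: "S \<in> Sp" and T: "S ** T = mat 1" shows "T \<in> Sp"
proof -
  have "transpose T ** (transpose S ** J_matrix ** S) ** T = transpose (S ** T) ** J_matrix ** (S ** T)"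
    by (simp add: matrix_transpose_mul matrix_mul_assoc)
  then show ?thesis
    using S by (simp add: T Sp_def transpose_mat)
qed

text \<open>A complex linear symplectic map is unitary: moving \<open>J_matrix\<close> past
  \<open>S\<close> in the symplectic relation leaves
  \<open>transpose S ** S ** J_matrix = J_matrix\<close>, and \<open>J_matrix\<close>
  cancels.\<close>

lemma Sp_commute_J_imp_orthogonal:
  assumes S: "S \<in> Sp" and "S ** J_matrix = J_matrix ** S"
  shows "transpose S ** S = mat 1"
proof -
  have "transpose S ** S ** J_matrix = J_matrix"
    using assms by (simp add: Sp_def flip: matrix_mul_assoc)
  then have "transpose S ** S ** (J_matrix ** J_matrix) = J_matrix ** J_matrix"
    by (simp add: matrix_mul_assoc)
  then show ?thesis
    by (simp add: J_matrix_square matrix_mul_minus)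
qed


section \<open>Permuting the coordinate planes\<close>

abbreviation plane_index :: "'n + 'n \<Rightarrow> 'n" where
  "plane_index \<equiv> case_sum id id"

text \<open>Only the zero pattern is recorded, not the values inside the blocks, so for products and
  transposes it suffices to track \<sigma>.\<close>

definition permutes_planes :: "('n \<Rightarrow> 'n) \<Rightarrow> 'n::finite dmat \<Rightarrow> bool" where
  "permutes_planes \<sigma> U \<longleftrightarrow> (\<forall>i j. plane_index i \<noteq> \<sigma> (plane_index j) \<longrightarrow> U $ i $ j = 0)"

lemma permutes_planes_mult:
  assumes "permutes_planes \<sigma> U" "permutes_planes \<tau> W"
  shows "permutes_planes (\<sigma> \<circ> \<tau>) (U ** W)"
  unfolding permutes_planes_def
proof (intro allI impI)
  fix i j assume "plane_index i \<noteq> (\<sigma> \<circ> \<tau>) (plane_index j)"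
  then have "U $ i $ m * W $ m $ j = 0" for m
    using assms unfolding permutes_planes_def
    by (cases "plane_index m = \<tau> (plane_index j)") simp_all
  then show "(U ** W) $ i $ j = 0"
    by (simp only: matrix_matrix_mult_def vec_lambda_beta sum.neutral_const)
qed

lemma permutes_planes_transpose:
  assumes "permutes_planes \<sigma> U" "bij \<sigma>"
  shows "permutes_planes (inv \<sigma>) (transpose U)"
  unfolding permutes_planes_def
proof (intro allI impI)
  fix i j assume "plane_index i \<noteq> inv \<sigma> (plane_index j)"
  then have "plane_index j \<noteq> \<sigma> (plane_index i)"
    using assms(2) by (auto simp: inv_f_f bij_is_inj)
  then show "transpose U $ i $ j = 0"
    using assms(1) by (simp add: permutes_planes_def transpose_def)
qed

text \<open>By complex linearity, the block of \<open>U\<close> from plane \<open>l\<close> to plane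
  \<open>\<sigma> l\<close> is a complex scalar. It commutes with the diagonal entry, so conjugation
  by \<open>U\<close> merely moves the entries along \<sigma>.\<close>

lemma permutes_planes_mult_cdiag:
  assumes "permutes_planes \<sigma> U" "bij \<sigma>" and J: "U ** J_matrix = J_matrix ** U"
  shows "U ** cdiag c s = cdiag (c \<circ> inv \<sigma>) (s \<circ> inv \<sigma>) ** U"
proof -
  have UJ: "U $ Inr k $ Inr l = U $ Inl k $ Inl l" "U $ Inr k $ Inl l = - U $ Inl k $ Inr l" for k l
    using J by (simp_all add: commute_J_matrix_iff)
  have zero: "U $ Inl k $ Inl l = 0" "U $ Inl k $ Inr l = 0" if "k \<noteq> \<sigma> l" for k l
    using that assms(1) by (simp_all add: permutes_planes_def)
  have inv: "inv \<sigma> (\<sigma> l) = l" for l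
    using assms(2) by (simp add: bij_is_inj)
  have "(U ** cdiag c s) $ i $ j = (cdiag (c \<circ> inv \<sigma>) (s \<circ> inv \<sigma>) ** U) $ i $ j" for i j
  proof (cases "plane_index i = \<sigma> (plane_index j)")
    case True
    then show ?thesis
      by (cases i; cases j) (simp_all add: cdiag_mult_nth mult_cdiag_nth UJ inv)
  next
    case False
    then show ?thesis
      by (cases i; cases j) (simp_all add: cdiag_mult_nth mult_cdiag_nth UJ zero)
  qed
  then show ?thesis
    by (simp add: vec_eq_iff)
qed

lemma permutes_planes_id_imp_cdiag:
  assumes "permutes_planes id U" and "U ** J_matrix = J_matrix ** U"
  shows "U = cdiag (\<lambda>k. U $ Inl k $ Inl k) (\<lambda>k. U $ Inl k $ Inr k)"
proof -
  have "U $ Inr k $ Inr l = U $ Inl k $ Inl l" "U $ Inr k $ Inl l = - U $ Inl k $ Inr l" for k l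
    using assms(2) by (simp_all add: commute_J_matrix_iff)
  moreover have "U $ Inl k $ Inl l = 0" "U $ Inl k $ Inr l = 0" if "k \<noteq> l" for k l
    using that assms(1) by (simp_all add: permutes_planes_def)
  ultimately show ?thesis
    unfolding sum_matrix_eq_iff by simp
qed

section \<open>Symplectic permutations and the plane permutations they realize\<close>

lemma symp_swap_nth:
  assumes "a \<noteq> b"
  shows
  "symp_swap a b $ Inl k $ Inl l = (if k = l \<and> k \<noteq> a \<and> k \<noteq> b then 1 else 0)"
  "symp_swap a b $ Inl k $ Inr l = (if k = a \<and> l = b \<or> k = b \<and> l = a then 1 else 0)"
  "symp_swap a b $ Inr k $ Inl l = (if k = a \<and> l = b \<or> k = b \<and> l = a then -1 else 0)"
  "symp_swap a b $ Inr k $ Inr l = (if k = l \<and> k \<noteq> a \<and> k \<noteq> b then 1 else 0)"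
  using assms by (auto simp: symp_swap_def symp_swap_image_def axis_def)

lemma symp_swap_commute_J: "a \<noteq> b \<Longrightarrow> symp_swap a b ** J_matrix = J_matrix ** symp_swap a b"
  by (simp add: commute_J_matrix_iff symp_swap_nth)

lemma permutes_planes_symp_swap:
  assumes "a \<noteq> b" shows "permutes_planes (Transposition.transpose a b) (symp_swap a b)"
proof -
  have "symp_swap a b $ i $ j = 0"
    if "plane_index i \<noteq> Transposition.transpose a b (plane_index j)" for i j
    using that assms
    by (cases i; cases j) (auto simp: symp_swap_nth Transposition.transpose_def split: if_splits)
  then show ?thesis
    by (simp add: permutes_planes_def)
qed

lemma symp_swap_orthogonal:
  assumes "a \<noteq> b" shows "transpose (symp_swap a b) ** symp_swap a b = mat 1"
proof -
  have "(\<Sum>m\<in>UNIV. symp_swap_image a b i $ m * symp_swap_image a b j $ m) = (if i = j then 1 else 0)"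
    for i j
  proof -
    have "symp_swap_image a b i \<bullet> symp_swap_image a b j = (if i = j then 1 else 0)"
      using assms by (auto simp: symp_swap_image_def inner_axis_axis)
    then show ?thesis
      by (simp add: inner_vec_def)
  qed
  then show ?thesis
    by (simp add: vec_eq_iff matrix_matrix_mult_def transpose_def symp_swap_def mat_def)
qed

lemma orthogonal_commute_J_imp_Sp:
  assumes "transpose S ** S = mat 1" and "S ** J_matrix = J_matrix ** S"
  shows "S \<in> Sp"
proof -
  have "transpose S ** J_matrix ** S = transpose S ** S ** J_matrix"
    by (metis assms(2) matrix_mul_assoc)
  then show ?thesis
    by (simp add: Sp_def assms(1))
qed

text \<open>Each \<open>symp_swap\<close> realizes a transposition of planes, and transpositions
  generate all permutations. Membership in \<open>Sp\<close> and commutation with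
  \<open>J_matrix\<close> are carried through the induction because together they make
  \<open>P\<close> unitary, which the splitting in (2) uses.\<close>

lemma symplectic_permutation_exists:
  fixes \<sigma> :: "'n::finite \<Rightarrow> 'n"
  assumes "bij \<sigma>"
  shows "\<exists>P. symplectic_permutation P \<and> permutes_planes \<sigma> P \<and> P \<in> Sp \<and>
    P ** J_matrix = J_matrix ** P"
proof -
  have "\<sigma> permutes UNIV"
    using assms bij_imp_permutes by blast
  from this finite_class.finite_UNIV show ?thesis
  proof (induction rule: permutes_induct)
    case id
    have "permutes_planes id (mat 1 :: 'n dmat)"
      by (auto simp: permutes_planes_def mat_def)
    moreover have "(mat 1 :: 'n dmat) \<in> Sp"
      by (simp add: Sp_def transpose_mat)
    moreover have "(mat 1 :: 'n dmat) ** J_matrix = J_matrix ** mat 1"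
      by simp
    ultimately show ?case
      using symplectic_permutation_empty by blast
  next
    case (swap a b p)
    then obtain P where P: "symplectic_permutation P" "permutes_planes p P" "P \<in> Sp"
      "P ** J_matrix = J_matrix ** P"
      by blast
    have "symp_swap a b \<in> Sp"
      using swap(3)
      by (simp add: orthogonal_commute_J_imp_Sp symp_swap_orthogonal symp_swap_commute_J)
    then have "symp_swap a b ** P \<in> Sp"
      using P by (simp add: Sp_mult)
    moreover have "symp_swap a b ** P ** J_matrix = J_matrix ** (symp_swap a b ** P)"
      using P(4) symp_swap_commute_J[OF swap(3)] by (metis matrix_mul_assoc)
    moreover have "symplectic_permutation (symp_swap a b ** P)"
      using P(1) swap(3) by (simp add: symplectic_permutation_swap)
    moreover have "permutes_planes (Transposition.transpose a b \<circ> p) (symp_swap a b ** P)"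
      using P(2) swap(3) by (simp add: permutes_planes_mult permutes_planes_symp_swap)
    ultimately show ?case
      by blast
  qed
qed

section \<open>Matrix inverses, and rotations as complex diagonal matrices\<close>

lemma matrix_inv_eqI:
  fixes X Y :: "real ^ 'n ^ 'n"
  assumes "X ** Y = mat 1" shows "matrix_inv X = Y"
proof -
  have "X ** matrix_inv X = mat 1 \<and> matrix_inv X ** X = mat 1"
    unfolding matrix_inv_def by (rule someI[of _ Y]) (use assms in \<open>simp add: matrix_left_right_inverse\<close>)
  then have "matrix_inv X = matrix_inv X ** (X ** Y)" "matrix_inv X ** X = mat 1"
    using assms by simp_all
  then show ?thesis
    by (simp add: matrix_mul_assoc)
qed

text \<open>Treating all planes at once turns a normal form into a single matrix equation, whose
  complex diagonal entries are exp(i \<phi>(k)).\<close>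

lemma acts_as_rotation_iff_cdiag:
  "(\<forall>k. acts_as_rotation R k (\<phi> k)) \<longleftrightarrow> R = cdiag (\<lambda>k. cos (\<phi> k)) (\<lambda>k. sin (\<phi> k))"
proof
  assume *: "\<forall>k. acts_as_rotation R k (\<phi> k)"
  have "R $ i $ Inl k = (cos (\<phi> k) *s axis (Inl k) 1 - sin (\<phi> k) *s axis (Inr k) 1 :: real ^ ('a + 'a)) $ i"
    "R $ i $ Inr k = (sin (\<phi> k) *s axis (Inl k) 1 + cos (\<phi> k) *s axis (Inr k) 1 :: real ^ ('a + 'a)) $ i"
    for i k
    using *[rule_format, of k] unfolding acts_as_rotation_def matrix_vector_mult_basis
    by (metis column_def vec_lambda_beta)+
  then show "R = cdiag (\<lambda>k. cos (\<phi> k)) (\<lambda>k. sin (\<phi> k))"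
    by (auto simp: sum_matrix_eq_iff axis_def)
next
  assume R: "R = cdiag (\<lambda>k. cos (\<phi> k)) (\<lambda>k. sin (\<phi> k))"
  show "\<forall>k. acts_as_rotation R k (\<phi> k)"
  proof
    fix k
    have nth: "(R *v axis j 1) $ i = R $ i $ j" for i j
      by (simp add: matrix_vector_mult_basis column_def)
    have l: "R *v axis (Inl k) 1 = cos (\<phi> k) *s axis (Inl k) 1 - sin (\<phi> k) *s axis (Inr k) 1"
    proof (rule iffD2[OF vec_eq_iff], rule allI)
      fix i show "(R *v axis (Inl k) 1) $ i
          = (cos (\<phi> k) *s axis (Inl k) 1 - sin (\<phi> k) *s axis (Inr k) 1) $ i"
        unfolding nth unfolding R by (cases i) (auto simp: axis_def)
    qed
    have r: "R *v axis (Inr k) 1 = sin (\<phi> k) *s axis (Inl k) 1 + cos (\<phi> k) *s axis (Inr k) 1"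
    proof (rule iffD2[OF vec_eq_iff], rule allI)
      fix i show "(R *v axis (Inr k) 1) $ i
          = (sin (\<phi> k) *s axis (Inl k) 1 + cos (\<phi> k) *s axis (Inr k) 1) $ i"
        unfolding nth unfolding R by (cases i) (auto simp: axis_def)
    qed
    have "(*v) R ` symp_plane k = span ((*v) R ` {axis (Inl k) 1, axis (Inr k) 1})"
      unfolding symp_plane_def by (rule linear_span_image[symmetric]) (rule matrix_vector_mul_linear)
    also have "\<dots> \<subseteq> symp_plane k"
      unfolding symp_plane_def
      by (intro span_minimal)
        (auto simp: l r scalar_mult_eq_scaleR intro!: span_add span_diff span_scale intro: span_base)
    finally show "acts_as_rotation R k (\<phi> k)"
      using l r by (simp add: acts_as_rotation_def)
  qed
qed


section \<open>The spectrum and the commutant of a normal form\<close>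

lemma complex_matrix_mult: "complex_matrix (X ** Y) = complex_matrix X ** complex_matrix Y"
  by (simp add: vec_eq_iff complex_matrix_def matrix_matrix_mult_def)

lemma complex_matrix_mat_1: "complex_matrix (mat 1) = mat 1"
  by (simp add: vec_eq_iff complex_matrix_def mat_def)

lemma complex_matrix_cdiag_mult_nth:
  "(complex_matrix (cdiag c s) *v w) $ Inl k = complex_of_real (c k) * w $ Inl k + complex_of_real (s k) * w $ Inr k"
  "(complex_matrix (cdiag c s) *v w) $ Inr k = - complex_of_real (s k) * w $ Inl k + complex_of_real (c k) * w $ Inr k"
  by (simp_all add: complex_matrix_def matrix_vector_mult_def sum_UNIV_Plus
      if_distrib[of "\<lambda>x. complex_of_real x * _"] if_distrib[of complex_of_real] if_distrib[of "\<lambda>x. x * _"] cong: if_cong)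

text \<open>An eigenvector, carried to normal form coordinates, has a nonzero component in some
  plane; there the eigenvalue is a root of the characteristic polynomial of a 2x2 block. The
  inclusion is what the counting argument below consumes.\<close>

lemma eigenvalues_normal_form:
  fixes M V V' :: "'n::finite dmat"
  assumes V: "V' ** V = mat 1" and R: "V' ** M ** V = cdiag c s"
  shows "eigenvalues (complex_matrix M) \<subseteq>
    range (case_sum (\<lambda>k. Complex (c k) (s k)) (\<lambda>k. Complex (c k) (- s k)))"
  (is "_ \<subseteq> range ?f")
proof
  fix \<mu> assume "\<mu> \<in> eigenvalues (complex_matrix M)"
  then obtain v where v: "v \<noteq> 0" "complex_matrix M *v v = \<mu> *s v"
    by (auto simp: eigenvalues_def)
  have V': "V ** V' = mat 1"
    using V by (simp add: matrix_left_right_inverse)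
  define w where "w = complex_matrix V' *v v"
  have "complex_matrix V *v w = v"
    unfolding w_def matrix_vector_mul_assoc
    by (simp add: V' complex_matrix_mat_1 flip: complex_matrix_mult)
  then have "w \<noteq> 0"
    using v(1) by auto
  have "cdiag c s ** V' = V' ** M ** (V ** V')"
    by (simp add: matrix_mul_assoc flip: R)
  then have "complex_matrix (cdiag c s) *v w = complex_matrix V' *v (complex_matrix M *v v)"
    unfolding w_def matrix_vector_mul_assoc
    by (simp add: V' flip: complex_matrix_mult)
  also have "\<dots> = \<mu> *s w"
    by (simp add: v w_def vector_scalar_commute)
  finally have eq: "complex_matrix (cdiag c s) *v w = \<mu> *s w" .
  obtain k where k: "w $ Inl k \<noteq> 0 \<or> w $ Inr k \<noteq> 0"
    using \<open>w \<noteq> 0\<close> by (metis old.sum.exhaust vec_eq_iff zero_index)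
  define x y C S where defs: "x = w $ Inl k" "y = w $ Inr k" "C = complex_of_real (c k)"
    "S = complex_of_real (s k)"
  have 1: "C * x + S * y = \<mu> * x" and 2: "- S * x + C * y = \<mu> * y"
    using eq[unfolded vec_eq_iff, rule_format, of "Inl k"] eq[unfolded vec_eq_iff, rule_format, of "Inr k"]
    by (simp_all add: complex_matrix_cdiag_mult_nth defs)
  \<comment> \<open>Eliminating one unknown from the 2x2 system: the characteristic polynomial at
    \<mu> annihilates both components.\<close>
  have "((\<mu> - C)\<^sup>2 + S\<^sup>2) * x = 0" "((\<mu> - C)\<^sup>2 + S\<^sup>2) * y = 0"
    using 1 2 by algebra+
  with k have "(\<mu> - C)\<^sup>2 + S\<^sup>2 = 0"
    by (auto simp: defs)
  then have "(\<mu> - C - \<i> * S) * (\<mu> - C + \<i> * S) = 0"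
    by (simp add: algebra_simps power2_eq_square)
  then have "\<mu> - C - \<i> * S = 0 \<or> \<mu> - C + \<i> * S = 0"
    by (simp only: mult_eq_0_iff)
  then have "\<mu> = C + \<i> * S \<or> \<mu> = C - \<i> * S"
    by (rule disj_forward) (simp_all add: algebra_simps)
  then have "\<mu> = ?f (Inl k) \<or> \<mu> = ?f (Inr k)"
    by (auto simp: defs complex_eq_iff)
  then show "\<mu> \<in> range ?f"
    by blast
qed

text \<open>The 2n candidates c + i s and c - i s cover a set of 2n eigenvalues, so no two of them
  coincide.\<close>

lemma simple_spectrum_normal_form:
  fixes M V V' :: "'n::finite dmat"
  assumes "V' ** V = mat 1" and "V' ** M ** V = cdiag c s"
    and norm: "\<And>k. (c k)\<^sup>2 + (s k)\<^sup>2 = 1"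
    and card: "card (eigenvalues (complex_matrix M)) = 2 * CARD('n)"
  shows "inj c" "s k \<noteq> 0"
proof -
  define f where "f = case_sum (\<lambda>k. Complex (c k) (s k)) (\<lambda>k. Complex (c k) (- s k))"
  have sub: "eigenvalues (complex_matrix M) \<subseteq> range f"
    unfolding f_def using assms(1,2) by (rule eigenvalues_normal_form)
  have "CARD('n + 'n) \<le> card (range f)"
    using card_mono[OF _ sub] card by (simp add: card_UNIV_sum)
  then have "inj f"
    using card_image_le[of UNIV f] by (intro eq_card_imp_inj_on) auto
  show "s k \<noteq> 0"
    using \<open>inj f\<close>[THEN injD, of "Inl k" "Inr k"] by (auto simp: f_def)
  show "inj c"
  proof
    \<comment> \<open>On the unit circle, equal real parts mean equal or conjugate numbers; both
      alternatives are comparisons of values of the injective \<open>f\<close>.\<close>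
    fix k l assume "c k = c l"
    with norm[of k] norm[of l] have "s k = s l \<or> s k = - s l"
      by (metis add_left_cancel power2_eq_iff)
    then show "k = l"
      using \<open>inj f\<close>[THEN injD, of "Inl k" "Inl l"] \<open>inj f\<close>[THEN injD, of "Inl k" "Inr l"] \<open>c k = c l\<close>
      by (auto simp: f_def)
  qed
qed

text \<open>The matrix \<open>cdiag c s\<close> is orthogonal, so invariance says that
  \<open>H\<close> commutes with it and with its transpose. Injectivity of \<open>c\<close> then
  kills the blocks between different planes, while \<open>s k \<noteq> 0\<close> and symmetry make
  each remaining block scalar.\<close>

lemma symmetric_invariant_imp_diagonal:
  fixes H :: "'n::finite dmat"
  assumes inv: "cdiag c s ** H ** transpose (cdiag c s) = H" and sym: "transpose H = H"
    and norm: "\<And>k. (c k)\<^sup>2 + (s k)\<^sup>2 = 1" and "inj c" and s: "\<And>k. s k \<noteq> 0"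
  shows "\<exists>\<gamma>. H = cdiag \<gamma> (\<lambda>_. 0)"
proof -
  define R where "R = cdiag c s"
  have RR: "transpose R ** R = mat 1"
    using norm by (simp add: R_def transpose_cdiag cdiag_mult mat_1_eq_cdiag cdiag_inject power2_eq_square)
  have "R ** H ** (transpose R ** R) = H ** R"
    using inv by (simp add: R_def matrix_mul_assoc)
  then have 1: "cdiag c s ** H = H ** cdiag c s"
    unfolding RR matrix_mul_rid unfolding R_def .
  have "(transpose R ** R) ** H ** transpose R = transpose R ** H"
    using inv by (simp add: R_def flip: matrix_mul_assoc)
  then have 2: "cdiag c (\<lambda>k. - s k) ** H = H ** cdiag c (\<lambda>k. - s k)"
    unfolding RR matrix_mul_lid unfolding R_def transpose_cdiag by simp
  note entries = 1[unfolded sum_matrix_eq_iff cdiag_mult_nth mult_cdiag_nth, rule_format]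
    2[unfolded sum_matrix_eq_iff cdiag_mult_nth mult_cdiag_nth, rule_format]
  note e11 = entries[THEN conjunct1]
    and e12 = entries[THEN conjunct2, THEN conjunct1]
    and e21 = entries[THEN conjunct2, THEN conjunct2, THEN conjunct1]
    and e22 = entries[THEN conjunct2, THEN conjunct2, THEN conjunct2]
  \<comment> \<open>Sums and differences of the two commutation relations separate the contributions
    of \<open>c\<close> and \<open>s\<close>.\<close>
  have eqs: "c k * H $ Inl k $ Inl l = c l * H $ Inl k $ Inl l"
      "s k * H $ Inr k $ Inl l = - s l * H $ Inl k $ Inr l" for k l
    using e11[of k l] by algebra+
  have eqs': "c k * H $ Inl k $ Inr l = c l * H $ Inl k $ Inr l"
      "s k * H $ Inr k $ Inr l = s l * H $ Inl k $ Inl l" for k l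
    using e12[of k l] by algebra+
  have eqs'': "c k * H $ Inr k $ Inl l = c l * H $ Inr k $ Inl l"
      "c k * H $ Inr k $ Inr l = c l * H $ Inr k $ Inr l" for k l
    using e21[of k l] e22[of k l] by algebra+
  have off: "H $ Inl k $ Inl l = 0" "H $ Inl k $ Inr l = 0" "H $ Inr k $ Inl l = 0" "H $ Inr k $ Inr l = 0"
    if "k \<noteq> l" for k l
    using eqs(1)[of k l] eqs'(1)[of k l] eqs''[of k l] that \<open>inj c\<close> by (auto dest: injD)
  \<comment> \<open>Within a plane, commutation makes the two off-diagonal entries opposite and
    symmetry makes them equal, so they vanish.\<close>
  have diag: "H $ Inr k $ Inr k = H $ Inl k $ Inl k" "H $ Inl k $ Inr k = 0" "H $ Inr k $ Inl k = 0" for k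
  proof -
    have "H $ Inr k $ Inl k = H $ Inl k $ Inr k"
      using arg_cong[OF sym, of "\<lambda>X. X $ Inl k $ Inr k"] by (simp add: transpose_def)
    moreover have "s k * H $ Inr k $ Inl k = s k * - H $ Inl k $ Inr k"
      using eqs(2)[of k k] by simp
    then have "H $ Inr k $ Inl k = - H $ Inl k $ Inr k"
      using s[of k] mult_left_cancel by blast
    moreover have "H $ Inr k $ Inr k = H $ Inl k $ Inl k"
      using eqs'(2)[of k k] s[of k] by simp
    ultimately show "H $ Inr k $ Inr k = H $ Inl k $ Inl k" "H $ Inl k $ Inr k = 0" "H $ Inr k $ Inl k = 0"
      by simp_all
  qed
  have "H = cdiag (\<lambda>k. H $ Inl k $ Inl k) (\<lambda>_. 0)"
    by (auto simp: sum_matrix_eq_iff off diag)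
  then show ?thesis
    by blast
qed


section \<open>Symplectic diagonalization of positive definite matrices\<close>

lemma positive_definite_congruence:
  fixes X Y H :: "real ^ 'n ^ 'n"
  assumes pd: "positive_definite (transpose X ** H ** X)" and "X ** Y = mat 1"
  shows "positive_definite H"
  unfolding positive_definite_def
proof (intro allI impI)
  fix x :: "real ^ 'n" assume "x \<noteq> 0"
  have x: "X *v (Y *v x) = x"
    by (simp add: matrix_vector_mul_assoc assms(2))
  then have "Y *v x \<noteq> 0"
    using \<open>x \<noteq> 0\<close> by auto
  then have "0 < (Y *v x) \<bullet> ((transpose X ** H ** X) *v (Y *v x))"
    using pd by (simp add: positive_definite_def)
  also have "(transpose X ** H ** X) *v (Y *v x) = transpose X *v (H *v x)"
    by (metis matrix_vector_mul_assoc x)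
  also have "(Y *v x) \<bullet> (transpose X *v (H *v x)) = x \<bullet> (H *v x)"
    by (metis x dot_lmul_matrix inner_commute transpose_matrix_vector)
  finally show "x \<bullet> (H *v x) > 0" .
qed

lemma positive_definite_cdiag_imp_pos:
  assumes "positive_definite (cdiag d s)" shows "d k > 0"
proof -
  have "axis (Inl k) 1 \<bullet> (cdiag d s *v axis (Inl k) 1) > 0"
    using assms by (simp add: positive_definite_def)
  then show ?thesis
    by (simp add: matrix_vector_mult_basis inner_axis' column_def)
qed

lemma invertible_row_column_nonzero:
  fixes X :: "real ^ 'n ^ 'n"
  assumes "invertible X"
  shows "\<exists>j. X $ i $ j \<noteq> 0" "\<exists>i. X $ i $ j \<noteq> 0"
proof -
  obtain Y where Y: "X ** Y = mat 1" "Y ** X = mat 1"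
    using assms by (auto simp: invertible_def)
  have *: "(\<Sum>m\<in>UNIV. X $ i $ m * Y $ m $ i) = 1" "(\<Sum>m\<in>UNIV. Y $ j $ m * X $ m $ j) = 1"
    using arg_cong[OF Y(1), of "\<lambda>Z. Z $ i $ i"] arg_cong[OF Y(2), of "\<lambda>Z. Z $ j $ j"]
    by (simp_all add: matrix_matrix_mult_def mat_def)
  show "\<exists>j. X $ i $ j \<noteq> 0"
    by (rule ccontr) (use *(1) in simp)
  show "\<exists>i. X $ i $ j \<noteq> 0"
    by (rule ccontr) (use *(2) in simp)
qed

text \<open>For symplectic \<open>U\<close> the congruence below is the similarity \<open>J D U = U J D'\<close>, whose squared form
  forces \<open>U\<close> to match the planes on which the squared frequencies agree.\<close>

lemma symplectic_congruence_of_diagonals: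
  fixes U :: "'n::finite dmat"
  assumes U: "U \<in> Sp" and eq: "transpose U ** cdiag \<alpha> (\<lambda>_. 0) ** U = cdiag \<gamma> (\<lambda>_. 0)"
    and pos: "\<And>k. \<alpha> k > 0" "\<And>k. \<gamma> k > 0" and "inj \<alpha>"
  shows "U ** J_matrix = J_matrix ** U" "\<exists>\<sigma>. bij \<sigma> \<and> permutes_planes \<sigma> U"
proof -
  \<comment> \<open>Symplecticity of the transpose replaces \<open>J_matrix\<close> by
    \<open>U ** J_matrix ** transpose U\<close>, which turns the congruence into a
    similarity.\<close>
  have "U ** J_matrix ** transpose U = J_matrix"
    using Sp_transpose[OF U] by (simp add: Sp_def)
  then have "(J_matrix ** cdiag \<alpha> (\<lambda>_. 0)) ** U = U ** (J_matrix ** cdiag \<gamma> (\<lambda>_. 0))"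
    by (simp add: matrix_mul_assoc flip: eq)
  then have "cdiag (\<lambda>_. 0) \<alpha> ** U = U ** cdiag (\<lambda>_. 0) \<gamma>"
    by (simp add: J_matrix_eq_cdiag cdiag_mult)
  note similar = this[unfolded sum_matrix_eq_iff cdiag_mult_nth mult_cdiag_nth, rule_format,
      simplified]
  have eqs: "\<alpha> k * U $ Inr k $ Inl l = - \<gamma> l * U $ Inl k $ Inr l"
     "\<alpha> k * U $ Inr k $ Inr l = \<gamma> l * U $ Inl k $ Inl l"
     "\<alpha> k * U $ Inl k $ Inl l = \<gamma> l * U $ Inr k $ Inr l"
     "- (\<alpha> k * U $ Inl k $ Inr l) = \<gamma> l * U $ Inr k $ Inl l" for k l
    using similar[of k l] by (simp_all add: mult.commute)
  \<comment> \<open>Applying the similarity twice gives a factor \<alpha>(k)^2 - \<gamma>(l)^2;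
    positivity rules out \<alpha>(k) = -\<gamma>(l), so it is nonzero.\<close>
  have zero: "U $ Inl k $ Inl l = 0 \<and> U $ Inl k $ Inr l = 0 \<and> U $ Inr k $ Inl l = 0 \<and> U $ Inr k $ Inr l = 0"
    if "\<alpha> k \<noteq> \<gamma> l" for k l
  proof -
    have "(\<alpha> k)\<^sup>2 \<noteq> (\<gamma> l)\<^sup>2"
      using that pos(1)[of k] pos(2)[of l] by (simp add: power2_eq_iff)
    moreover have "((\<alpha> k)\<^sup>2 - (\<gamma> l)\<^sup>2) * U $ Inl k $ Inl l = 0" "((\<alpha> k)\<^sup>2 - (\<gamma> l)\<^sup>2) * U $ Inl k $ Inr l = 0"
      "((\<alpha> k)\<^sup>2 - (\<gamma> l)\<^sup>2) * U $ Inr k $ Inl l = 0" "((\<alpha> k)\<^sup>2 - (\<gamma> l)\<^sup>2) * U $ Inr k $ Inr l = 0"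
      using eqs[of k l] by algebra+
    ultimately show ?thesis
      by simp
  qed
  \<comment> \<open>On matching planes the equal positive factors cancel, leaving exactly
    commutation with \<open>J_matrix\<close>.\<close>
  have "U $ Inr k $ Inr l = U $ Inl k $ Inl l \<and> U $ Inr k $ Inl l = - U $ Inl k $ Inr l" for k l
  proof (cases "\<alpha> k = \<gamma> l")
    case True
    have "\<gamma> l * U $ Inr k $ Inl l = \<gamma> l * - U $ Inl k $ Inr l" "\<gamma> l \<noteq> 0"
      using eqs(1)[of k l] pos(2)[of l] True by simp_all
    then have "U $ Inr k $ Inl l = - U $ Inl k $ Inr l"
      using mult_left_cancel by blast
    then show ?thesis
      using eqs(2)[of k l] pos(2)[of l] True by simp
  qed (simp add: zero)
  then show "U ** J_matrix = J_matrix ** U"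
    by (simp add: commute_J_matrix_iff)
  \<comment> \<open>Invertibility supplies \<sigma>: nonzero columns give a matching \<alpha> for
    every \<gamma>, and nonzero rows with injectivity of \<alpha> give surjectivity, hence
    bijectivity on a finite type.\<close>
  have "\<exists>k. \<alpha> k = \<gamma> l" for l
  proof -
    obtain i where "U $ i $ Inl l \<noteq> 0"
      using invertible_row_column_nonzero(2)[OF Sp_invertible[OF U]] by blast
    then show ?thesis
      using zero by (cases i) auto
  qed
  then obtain \<sigma> where \<sigma>: "\<alpha> (\<sigma> l) = \<gamma> l" for l
    by metis
  have "\<exists>l. k = \<sigma> l" for k
  proof -
    obtain j where "U $ Inl k $ j \<noteq> 0"
      using invertible_row_column_nonzero(1)[OF Sp_invertible[OF U]] by blast
    then obtain l where "\<alpha> k = \<gamma> l"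
      using zero by (cases j) auto
    then show ?thesis
      using \<open>inj \<alpha>\<close> \<sigma> by (metis injD)
  qed
  then have "bij \<sigma>"
    by (simp add: bij_def finite_UNIV_surj_inj surj_def)
  moreover have "permutes_planes \<sigma> U"
    unfolding permutes_planes_def
  proof (intro allI impI)
    fix i j assume "plane_index i \<noteq> \<sigma> (plane_index j)"
    then have "\<alpha> (plane_index i) \<noteq> \<gamma> (plane_index j)"
      using \<open>inj \<alpha>\<close> \<sigma> by (metis injD)
    then show "U $ i $ j = 0"
      using zero by (cases i; cases j) simp_all
  qed
  ultimately show "\<exists>\<sigma>. bij \<sigma> \<and> permutes_planes \<sigma> U"
    by blast
qed


section \<open>Uniqueness of the Iwasawa decomposition\<close>

text \<open>\<open>Y\<close> is the upper half \<open>(B E, B F)\<close> of \<open>A N\<close>: its \<open>Inl\<close> columns form a Cholesky factor, which is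
  determined row by row, and the \<open>Inr\<close> columns follow.\<close>

lemma cholesky_unique:
  fixes Y Y' :: "'n::{finite,linorder} \<Rightarrow> 'n + 'm \<Rightarrow> real"
  assumes upper: "\<And>k i. i < k \<Longrightarrow> Y k (Inl i) = 0" "\<And>k i. i < k \<Longrightarrow> Y' k (Inl i) = 0"
    and pos: "\<And>k. Y k (Inl k) > 0" "\<And>k. Y' k (Inl k) > 0"
    and eq: "\<And>i j. (\<Sum>k\<in>UNIV. Y k (Inl i) * Y k j) = (\<Sum>k\<in>UNIV. Y' k (Inl i) * Y' k j)"
  shows "Y = Y'"
proof -
  \<comment> \<open>Strong induction along the finite linear order, measured by the number of
    smaller indices.\<close>
  have "Y i = Y' i" for i
  proof (induction i rule: measure_induct_rule[of "\<lambda>i. card {k. k < i}"])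
    case (less i)
    have IH: "Y k = Y' k" if "k < i" for k
      using that by (intro less psubset_card_mono) auto
    have row: "Y i (Inl i) * Y i j = Y' i (Inl i) * Y' i j" for j
    proof -
      \<comment> \<open>Earlier rows agree by induction and later rows vanish in column
        \<open>Inl i\<close>, so only the summand of row \<open>i\<close> remains to
        compare.\<close>
      have "Y k (Inl i) * Y k j = Y' k (Inl i) * Y' k j" if "k \<noteq> i" for k
        using that by (cases "k < i") (auto simp: IH upper)
      then have "(\<Sum>k\<in>UNIV - {i}. Y k (Inl i) * Y k j) = (\<Sum>k\<in>UNIV - {i}. Y' k (Inl i) * Y' k j)"
        by (intro sum.cong) auto
      then show ?thesis
        using eq[of i j] by (simp add: sum.remove[of UNIV i])
    qed
    have "(Y i (Inl i))\<^sup>2 = (Y' i (Inl i))\<^sup>2"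
      using row[of "Inl i"] by (simp add: power2_eq_square)
    then have "Y i (Inl i) = Y' i (Inl i)"
      using pos[of i] by (simp add: power2_eq_iff)
    then have "Y i j = Y' i j" for j
      using row[of j] pos(1)[of i] by (metis mult_cancel_left order_less_irrefl)
    then show ?case
      by blast
  qed
  then show ?thesis
    by blast
qed

text \<open>Passing to \<open>transpose S ** S\<close> removes the orthogonal factor. The lower left
  block of \<open>A ** N\<close> is zero, so the Cholesky argument fixes its upper half; the unit
  diagonal of \<open>E\<close> reveals \<open>b\<close>, then \<open>E\<close> and \<open>F\<close>
  follow, and \<open>E\<close> fixes the lower right block of \<open>N\<close>. Cancelling the
  invertible \<open>A ** N\<close> recovers \<open>K\<close>.\<close>

lemma iwasawa_unique:
  fixes S K A N K' A' N' :: "'n::{finite,linorder} dmat"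
  assumes "iwasawa_decomposition S K A N" "iwasawa_decomposition S K' A' N'"
  shows "K = K'" "A = A'" "N = N'"
proof -
  have K: "transpose K ** K = mat 1" "transpose K' ** K' = mat 1"
    and Sp: "A \<in> Sp" "N \<in> Sp"
    and S: "S = K ** A ** N" "S = K' ** A' ** N'"
    using assms by (auto simp: iwasawa_decomposition_def iwasawa_K_def iwasawa_A_def iwasawa_N_def
        orthogonal_matrix_def)
  obtain b where b: "\<And>k. b k > 0" "A = block_matrix (diag_matrix b) 0 0 (matrix_inv (diag_matrix b))"
    using assms(1) by (auto simp: iwasawa_decomposition_def iwasawa_A_def)
  obtain b' where b': "\<And>k. b' k > 0" "A' = block_matrix (diag_matrix b') 0 0 (matrix_inv (diag_matrix b'))"
    using assms(2) by (auto simp: iwasawa_decomposition_def iwasawa_A_def)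
  obtain E F where E: "unit_upper_triangular E" "N = block_matrix E F 0 (transpose (matrix_inv E))"
    using assms(1) by (auto simp: iwasawa_decomposition_def iwasawa_N_def)
  obtain E' F' where E': "unit_upper_triangular E'" "N' = block_matrix E' F' 0 (transpose (matrix_inv E'))"
    using assms(2) by (auto simp: iwasawa_decomposition_def iwasawa_N_def)
  have nth: "(block_matrix (diag_matrix d) 0 0 B ** block_matrix X Z 0 W) $ Inl k $ Inl l = d k * X $ k $ l"
    "(block_matrix (diag_matrix d) 0 0 B ** block_matrix X Z 0 W) $ Inl k $ Inr l = d k * Z $ k $ l"
    "(block_matrix (diag_matrix d) 0 0 B ** block_matrix X Z 0 W) $ Inr k $ Inl l = 0"
    for d :: "'n \<Rightarrow> real" and B X Z W k l
    by (simp_all add: matrix_matrix_mult_def sum_UNIV_Plus diag_matrix_nth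
        if_distrib[of "\<lambda>x. x * _"] cong: if_cong)
  define T T' where "T = A ** N" and "T' = A' ** N'"
  have "transpose S ** S = transpose T ** (transpose K ** K) ** T"
    by (simp add: S(1) T_def matrix_transpose_mul matrix_mul_assoc)
  moreover have "transpose S ** S = transpose T' ** (transpose K' ** K') ** T'"
    by (simp add: S(2) T'_def matrix_transpose_mul matrix_mul_assoc)
  ultimately have TT: "transpose T ** T = transpose T' ** T'"
    by (simp add: K)
  have gram: "(transpose X ** X) $ Inl i $ j = (\<Sum>k\<in>UNIV. X $ Inl k $ Inl i * X $ Inl k $ j)"
    if "\<And>k l. X $ Inr k $ Inl l = 0" for X :: "'n dmat" and i j
    by (simp add: matrix_matrix_mult_def transpose_def sum_UNIV_Plus that)
  have lower: "T $ Inr k $ Inl l = 0" "T' $ Inr k $ Inl l = 0" for k l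
    by (simp_all add: T_def T'_def b(2) b'(2) E(2) E'(2) nth)
  have rows: "(\<lambda>k j. T $ Inl k $ j) = (\<lambda>k j. T' $ Inl k $ j)"
  proof (rule cholesky_unique)
    fix i j
    have "(transpose T ** T) $ Inl i $ j = (transpose T' ** T') $ Inl i $ j"
      by (simp add: TT)
    then show "(\<Sum>k\<in>UNIV. T $ Inl k $ Inl i * T $ Inl k $ j) = (\<Sum>k\<in>UNIV. T' $ Inl k $ Inl i * T' $ Inl k $ j)"
      by (simp add: gram lower)
  qed (use b(1) b'(1) E(1) E'(1) in \<open>simp_all add: T_def T'_def b(2) b'(2) E(2) E'(2) nth unit_upper_triangular_def\<close>)
  have bE: "b k * E $ k $ l = b' k * E' $ k $ l" "b k * F $ k $ l = b' k * F' $ k $ l" for k l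
    using fun_cong[OF fun_cong[OF rows, of k], of "Inl l"] fun_cong[OF fun_cong[OF rows, of k], of "Inr l"]
    by (simp_all add: T_def T'_def b(2) b'(2) E(2) E'(2) nth)
  have bb: "b k = b' k" for k
    using bE(1)[of k k] E(1) E'(1) by (simp add: unit_upper_triangular_def)
  then have "b = b'"
    by blast
  have "b' k \<noteq> 0" for k
    using b'(1)[of k] by simp
  then have "E = E'" "F = F'"
    using bE by (simp_all add: vec_eq_iff bb)
  show "A = A'" "N = N'"
    by (simp_all add: b(2) b'(2) E(2) E'(2) \<open>b = b'\<close> \<open>E = E'\<close> \<open>F = F'\<close>)
  obtain T1 where T1: "T ** T1 = mat 1"
    using Sp_invertible[OF Sp_mult[OF Sp]] by (auto simp: T_def invertible_def)
  have "K ** T = K' ** T"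
    using S by (simp add: T_def \<open>A = A'\<close> \<open>N = N'\<close> matrix_mul_assoc)
  then have "K ** (T ** T1) = K' ** (T ** T1)"
    by (simp add: matrix_mul_assoc)
  then show "K = K'"
    by (simp add: T1)
qed

section \<open>Joining spectrum, congruence and Iwasawa uniqueness\<close>

theorem mainTheorem4:
  fixes M V G S D K A N K' A' N' :: "'n::{finite,linorder} dmat"
    and \<Lambda> :: "'n \<Rightarrow> real"
  assumes "M \<in> Sp"
    and "diagonalizable (complex_matrix M)"
    and "card (eigenvalues (complex_matrix M)) = 2 * CARD('n)"
    and "\<forall>\<mu>\<in>eigenvalues (complex_matrix M). cmod \<mu> = 1"
    and "linear_normal_form_map M V"
    and "symmetric_matrix G" and "positive_definite G"
    and "M ** G ** transpose M = G"
    and "S \<in> Sp"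
    and "D = block_matrix (diag_matrix \<Lambda>) 0 0 (diag_matrix \<Lambda>)"
    and "inj \<Lambda>"
    and "G = transpose S ** D ** S"
    and "iwasawa_decomposition S K A N"
    and "iwasawa_decomposition (transpose V) K' A' N'"
  shows "A = A' \<and> N = N' \<and>
    (\<exists>P D1 D2 \<Delta>1 \<Delta>2.
       symplectic_permutation P \<and>
       D1 = block_matrix (diag_matrix \<Delta>1) 0 0 (diag_matrix \<Delta>1) \<and>
       D2 = block_matrix (diag_matrix \<Delta>2) 0 0 (diag_matrix \<Delta>2) \<and>
       D1 ** D1 + D2 ** D2 = mat 1 \<and>
       K = P ** (D1 + J_matrix ** D2) ** K') \<and>
    linear_normal_form_map M (transpose S)"
proof -
  have V: "V \<in> Sp"
    using assms(5) by (simp add: linear_normal_form_map_def)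
  then obtain V' where V': "V ** V' = mat 1" "V' ** V = mat 1"
    using Sp_invertible by (auto simp: invertible_def)
  have tV': "transpose V' ** transpose V = mat 1" "transpose V ** transpose V' = mat 1"
    using V' by (simp_all add: transpose_mat flip: matrix_transpose_mul)
  have cancel: "Z ** V ** V' = Z" "Z ** V' ** V = Z" "Z ** transpose V' ** transpose V = Z"
    "Z ** transpose V ** transpose V' = Z" for Z
    using V' tV' by (simp_all flip: matrix_mul_assoc)
  obtain \<phi> where \<phi>: "\<And>k. \<phi> k \<in> {0..<2*pi}" "\<And>k. acts_as_rotation (V' ** M ** V) k (\<phi> k)"
    using assms(5) unfolding linear_normal_form_map_def matrix_inv_eqI[OF V'(1)] by metis
  define c s where "c = (\<lambda>k. cos (\<phi> k))" and "s = (\<lambda>k. sin (\<phi> k))"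
  have R: "V' ** M ** V = cdiag c s"
    using \<phi>(2) acts_as_rotation_iff_cdiag unfolding c_def s_def by blast
  have norm: "(c k)\<^sup>2 + (s k)\<^sup>2 = 1" for k
    by (simp add: c_def s_def)

  \<comment> \<open>The form \<open>G\<close> in normal form coordinates: invariance under
    \<open>M\<close> becomes invariance under \<open>cdiag c s\<close>.\<close>
  define H where "H = V' ** G ** transpose V'"
  have "cdiag c s ** H ** transpose (cdiag c s) = V' ** (M ** G ** transpose M) ** transpose V'"
    by (simp add: H_def matrix_transpose_mul matrix_mul_assoc cancel flip: R)
  then have H_inv: "cdiag c s ** H ** transpose (cdiag c s) = H"
    by (simp add: assms(8) H_def)
  have H_sym: "transpose H = H"
    using assms(6) by (simp add: H_def matrix_transpose_mul matrix_mul_assoc symmetric_matrix_def)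
  obtain \<gamma> where \<gamma>: "H = cdiag \<gamma> (\<lambda>_. 0)"
    using symmetric_invariant_imp_diagonal[OF H_inv H_sym norm
        simple_spectrum_normal_form[OF V'(2) R norm assms(3)]] by blast
  have "G = transpose (transpose V) ** H ** transpose V"
    by (simp add: H_def matrix_mul_assoc cancel V')
  then have "positive_definite H"
    using assms(7) tV'(2) by (metis positive_definite_congruence)
  then have \<gamma>_pos: "\<gamma> k > 0" for k
    unfolding \<gamma> by (rule positive_definite_cdiag_imp_pos)

  have D: "D = cdiag \<Lambda> (\<lambda>_. 0)"
    by (simp add: assms(10) block_diag_eq_cdiag)
  obtain S' where S': "S ** S' = mat 1"
    using Sp_invertible[OF assms(9)] by (auto simp: invertible_def)
  have "positive_definite D"
    using assms(7) S' unfolding assms(12) by (rule positive_definite_congruence)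
  then have \<Lambda>_pos: "\<Lambda> k > 0" for k
    unfolding D by (rule positive_definite_cdiag_imp_pos)

  define U where "U = S ** transpose V'"
  have S: "S = U ** transpose V"
    by (simp add: U_def cancel)
  have U: "U \<in> Sp"
    unfolding U_def using assms(9) Sp_inverse[OF V V'(1)] by (intro Sp_mult Sp_transpose)
  have "transpose U ** cdiag \<Lambda> (\<lambda>_. 0) ** U = cdiag \<gamma> (\<lambda>_. 0)"
    by (simp add: U_def H_def assms(12) matrix_transpose_mul matrix_mul_assoc flip: D \<gamma>)
  note U_props = symplectic_congruence_of_diagonals[OF U this \<Lambda>_pos \<gamma>_pos assms(11)]
  have UJ: "U ** J_matrix = J_matrix ** U"
    by (rule U_props)
  obtain \<sigma> where \<sigma>: "bij \<sigma>" "permutes_planes \<sigma> U"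
    using U_props(2) by blast
  have U_orth: "transpose U ** U = mat 1" "U ** transpose U = mat 1"
    using Sp_commute_J_imp_orthogonal[OF U UJ] by (simp_all add: matrix_left_right_inverse)

  \<comment> \<open>Since \<open>U\<close> is orthogonal and symplectic, it is absorbed into the
    factor \<open>K'\<close>, which gives a second decomposition of \<open>S\<close>.\<close>
  have "iwasawa_decomposition S (U ** K') A' N'"
    using assms(14) U U_orth
    by (auto simp: iwasawa_decomposition_def iwasawa_K_def S matrix_mul_assoc Sp_mult
        orthogonal_matrix_mul orthogonal_matrix_def[of U])
  note unique = iwasawa_unique[OF assms(13) this]

  obtain P where P: "symplectic_permutation P" "permutes_planes \<sigma> P" "P \<in> Sp"
      "P ** J_matrix = J_matrix ** P"
    using symplectic_permutation_exists[OF \<sigma>(1)] by blast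
  have P_orth: "transpose P ** P = mat 1" "P ** transpose P = mat 1"
    using Sp_commute_J_imp_orthogonal[OF P(3,4)] by (simp_all add: matrix_left_right_inverse)
  \<comment> \<open>The plane permutations of \<open>transpose P\<close> and \<open>U\<close>
    cancel, so \<open>W\<close> is complex diagonal; its unitarity is the relation between \<Delta>1
    and \<Delta>2.\<close>
  define W where "W = transpose P ** U"
  have "transpose P ** (P ** J_matrix) ** transpose P = transpose P ** (J_matrix ** P) ** transpose P"
    by (simp add: P(4))
  then have PJ: "transpose P ** J_matrix = J_matrix ** transpose P"
    by (simp add: matrix_mul_assoc P_orth) (simp add: P_orth flip: matrix_mul_assoc)
  have "W ** J_matrix = transpose P ** J_matrix ** U"
    by (simp add: W_def UJ flip: matrix_mul_assoc)
  then have WJ: "W ** J_matrix = J_matrix ** W"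
    by (simp add: W_def PJ matrix_mul_assoc)
  have "permutes_planes (inv \<sigma> \<circ> \<sigma>) W"
    unfolding W_def using \<sigma> P(2) by (intro permutes_planes_mult permutes_planes_transpose)
  then obtain d e where W: "W = cdiag d e"
    using permutes_planes_id_imp_cdiag[OF _ WJ] \<sigma>(1) by (auto simp: bij_is_inj)
  have "transpose W ** W = transpose U ** (P ** transpose P) ** U"
    by (simp add: W_def matrix_transpose_mul matrix_mul_assoc)
  then have "cdiag d (\<lambda>k. - e k) ** cdiag d e = mat 1"
    by (simp add: P_orth U_orth W transpose_cdiag)
  then have de: "d k * d k + e k * e k = 1" for k
    by (simp add: cdiag_mult mat_1_eq_cdiag cdiag_inject fun_eq_iff)
  let ?D1 = "block_matrix (diag_matrix d) 0 0 (diag_matrix d)"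
  let ?D2 = "block_matrix (diag_matrix e) 0 0 (diag_matrix e)"
  have "?D1 ** ?D1 + ?D2 ** ?D2 = mat 1"
    by (simp add: block_diag_eq_cdiag cdiag_mult cdiag_add mat_1_eq_cdiag cdiag_inject de)
  moreover have "?D1 + J_matrix ** ?D2 = W"
    by (simp add: block_diag_eq_cdiag J_matrix_eq_cdiag cdiag_mult cdiag_add W)
  then have "K = P ** (?D1 + J_matrix ** ?D2) ** K'"
    by (simp add: unique W_def matrix_mul_assoc P_orth)

  moreover have "linear_normal_form_map M (transpose S)"
    unfolding linear_normal_form_map_def
  proof (intro conjI allI)
    show "transpose S \<in> Sp"
      using assms(9) by (rule Sp_transpose)
    have "transpose S ** (U ** V') = V ** (transpose U ** U) ** V'"
      by (simp add: S matrix_transpose_mul matrix_mul_assoc)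
    then have inv: "matrix_inv (transpose S) = U ** V'"
      by (intro matrix_inv_eqI) (simp add: U_orth V')
    \<comment> \<open>As \<open>transpose S\<close> is \<open>V ** transpose U\<close>, this
      conjugates the normal form by \<open>U\<close>; the new angles are the old ones reindexed by
      \<open>inv \<sigma>\<close>, so they stay in the required interval.\<close>
    have "U ** V' ** M ** transpose S = U ** (V' ** M ** V) ** transpose U"
      by (simp add: S matrix_transpose_mul matrix_mul_assoc)
    also have "\<dots> = cdiag (c \<circ> inv \<sigma>) (s \<circ> inv \<sigma>) ** (U ** transpose U)"
      by (simp add: R permutes_planes_mult_cdiag[OF \<sigma>(2,1) UJ] matrix_mul_assoc)
    finally have "U ** V' ** M ** transpose S
        = cdiag (\<lambda>k. cos (\<phi> (inv \<sigma> k))) (\<lambda>k. sin (\<phi> (inv \<sigma> k)))"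
      by (simp add: U_orth c_def s_def o_def)
    then have "acts_as_rotation (matrix_inv (transpose S) ** M ** transpose S) k (\<phi> (inv \<sigma> k))" for k
      unfolding inv using acts_as_rotation_iff_cdiag[of _ "\<lambda>k. \<phi> (inv \<sigma> k)"] by blast
    then show "\<exists>\<psi>\<in>{0..<2 * pi}. acts_as_rotation (matrix_inv (transpose S) ** M ** transpose S) k \<psi>" for k
      using \<phi>(1) by blast
  qed
  ultimately show ?thesis
    using unique P(1) by blast
qed

end
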